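(* Let $R$ be an algebraically closed field, $\mathfrak G$ the matroid of a hyperplane arrangement on $[n]$, $\Gamma\in\mathcal{NP}(\mathfrak G,R)$, $K=K(\Gamma,R)$, and suppose $\overline V(\Gamma)$ is nonempty. If $\lambda\in V^1(\Gamma,R)$ and $\eta\in Z_\Gamma(\lambda)$ is not parallel to $\lambda$, then for every block $S$ of $\Gamma$ the projective line $\lambda\ast\eta$ meets $\mathbb P(D_S)$. Conversely, if $\lambda,\eta\in K$ are not parallel and the line $L=\lambda\ast\eta$ in $\mathbb P(K)$ meets $\mathbb P(D_S)$ for every block $S$ of $\Gamma$, then $L\subseteq\overline V(\Gamma)$.
   Context: Let $\mathcal A=\{H_1,\dots,H_n\}$ be an arrangement of distinct linear hyperplanes in $\mathbb C^\ell$ and $\mathfrak G$ its matroid on $[n]$. A line of $\mathfrak G$ is a set $X=\{k: H_k\supseteq H_i\cap H_j\}$ for some $i\ne j$; $\mathcal X(\mathfrak G)$ is the set of lines, $\mathcal X_0(\mathfrak G)$ those with $|X|\ge3$. For $\xi\in R^n$ and $X\subseteq[n]$, $\xi_X=\sum_{i\in X}\xi_i$. Vectors $\xi,\nu$ are parallel if all $\xi_i\nu_j-\xi_j\nu_i=0$. For a graph $\Gamma$ on $[n]$: clique = set of pairwise adjacent vertices, block = maximal clique, cone vertex = vertex adjacent to all others; $\Gamma$ is $\mathfrak G$-neighborly if for all $X\in\mathcal X(\mathfrak G)$ and blocks $S$, $|X\cap S|\ge|X|-1$ implies $X\subseteq S$. $\mathcal X_\Gamma(\mathfrak G)=\{X\in\mathcal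 X_0(\mathfrak G):X\text{ not a clique of }\Gamma\}$; $K(\Gamma,R)=\{\xi\in R^n:\xi_X=0\ \forall X\in\mathcal X_\Gamma(\mathfrak G)\}$. For $\lambda\in K(\Gamma,R)$, $Z_\Gamma(\lambda)$ is the set of $\eta\in K(\Gamma,R)$ with $\lambda_i\eta_j-\lambda_j\eta_i=0$ for every edge $\{i,j\}$ of $\Gamma$ (the further condition $\lambda_X(\eta_i)_{i\in X}=\eta_X(\lambda_i)_{i\in X}$ for $X\in\mathcal X_\Gamma(\mathfrak G)$ is automatic). $V^1(\Gamma,R)=\{\lambda\in K(\Gamma,R):\exists\,\eta\in Z_\Gamma(\lambda)\text{ not parallel to }\lambda\}$, and $\overline V(\Gamma)\subseteq\mathbb P(K)$ is its projective image. $\mathcal{NP}(\mathfrak G,R)$ is the set of $\mathfrak G$-neighborly graphs on $[n]$ whose induced subgraph on non-cone vertices is transitive and with $\dim K(\Gamma,R)\ge2$. For a block $S$ of $\Gamma$, $D_S=\{\xi\in K:\xi_i=0\text{ for all }i\in S\}$. $\mathbb P(K)$ is the projective space of lines through $0$ in $K$; for non-parallel nonzero $\lambda,\eta$, $\lambda\ast\eta=\mathbb P(R\lambda+R\eta)$. *)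

theory Defs
  imports "HOL-Analysis.Analysis" "HOL-Computational_Algebra.Computational_Algebra"
begin

text \<open>
  The index set \<open>[n]\<close> is a finite type \<open>'n\<close>, the ambient space is \<open>complex ^ 'l\<close>, and
  \<open>R\<^sup>n\<close> is \<open>'a ^ 'n\<close>. Linear algebra over the field \<open>'a\<close> and over \<open>complex\<close> is that of the
  interpretation \<open>vec\<close> (scaling by \<open>*s\<close>); note that the unqualified \<open>dim\<close>, \<open>span\<close> and
  \<open>subspace\<close> are over the reals.
\<close>

definition linear_hyperplane :: "(complex ^ 'l) set \<Rightarrow> bool" where
  "linear_hyperplane W \<longleftrightarrow> vec.subspace W \<and> vec.dim W + 1 = CARD('l)"

definition arrangement :: "('n::finite \<Rightarrow> (complex ^ 'l) set) \<Rightarrow> bool" where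
  "arrangement H \<longleftrightarrow> (\<forall>i. linear_hyperplane (H i)) \<and> inj H"

text \<open>
  The matroid enters everything below only through its lines (the flats of rank two).
\<close>

definition matroid_lines :: "('n::finite \<Rightarrow> (complex ^ 'l) set) \<Rightarrow> 'n set set" where
  "matroid_lines H = {X. \<exists>i j. i \<noteq> j \<and> X = {k. H i \<inter> H j \<subseteq> H k}}"

definition matroid_lines0 :: "('n::finite \<Rightarrow> (complex ^ 'l) set) \<Rightarrow> 'n set set" where
  "matroid_lines0 H = {X \<in> matroid_lines H. card X \<ge> 3}"

text \<open>A simple graph is given by its adjacency relation.\<close>

definition simple_graph :: "('n \<times> 'n) set \<Rightarrow> bool" where
  "simple_graph \<Gamma> \<longleftrightarrow> sym \<Gamma> \<and> irrefl \<Gamma>"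

definition clique :: "('n \<times> 'n) set \<Rightarrow> 'n set \<Rightarrow> bool" where
  "clique \<Gamma> S \<longleftrightarrow> (\<forall>i\<in>S. \<forall>j\<in>S. i \<noteq> j \<longrightarrow> (i, j) \<in> \<Gamma>)"

definition block :: "('n \<times> 'n) set \<Rightarrow> 'n set \<Rightarrow> bool" where
  "block \<Gamma> S \<longleftrightarrow> clique \<Gamma> S \<and> (\<forall>T. clique \<Gamma> T \<and> S \<subseteq> T \<longrightarrow> T = S)"

definition cone_vertex :: "('n \<times> 'n) set \<Rightarrow> 'n \<Rightarrow> bool" where
  "cone_vertex \<Gamma> i \<longleftrightarrow> (\<forall>j. j \<noteq> i \<longrightarrow> (i, j) \<in> \<Gamma>)"

definition induced_subgraph :: "('n \<times> 'n) set \<Rightarrow> 'n set \<Rightarrow> ('n \<times> 'n) set" where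
  "induced_subgraph \<Gamma> W = \<Gamma> \<inter> W \<times> W"

text \<open>
  A graph is transitive if \<open>i \<sim> j\<close> and \<open>j \<sim> k\<close> imply \<open>i \<sim> k\<close> for pairwise distinct
  vertices. As adjacency is irreflexive, this is transitivity of its reflexive closure.
\<close>

definition transitive_graph :: "('n \<times> 'n) set \<Rightarrow> bool" where
  "transitive_graph \<Gamma> \<longleftrightarrow> trans (\<Gamma>\<^sup>=)"

definition neighborly ::
  "('n::finite \<Rightarrow> (complex ^ 'l) set) \<Rightarrow> ('n \<times> 'n) set \<Rightarrow> bool" where
  "neighborly H \<Gamma> \<longleftrightarrow>
     (\<forall>X\<in>matroid_lines H. \<forall>S. block \<Gamma> S \<and> card (X \<inter> S) \<ge> card X - 1 \<longrightarrow> X \<subseteq> S)"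

definition nonclique_lines ::
  "('n::finite \<Rightarrow> (complex ^ 'l) set) \<Rightarrow> ('n \<times> 'n) set \<Rightarrow> 'n set set" where
  "nonclique_lines H \<Gamma> = {X \<in> matroid_lines0 H. \<not> clique \<Gamma> X}"

definition subsum :: "'a::field ^ 'n::finite \<Rightarrow> 'n set \<Rightarrow> 'a" where
  "subsum \<xi> X = (\<Sum>i\<in>X. \<xi> $ i)"

definition parallel_vec :: "'a::field ^ 'n \<Rightarrow> 'a ^ 'n \<Rightarrow> bool" where
  "parallel_vec \<xi> \<nu> \<longleftrightarrow> (\<forall>i j. \<xi> $ i * \<nu> $ j - \<xi> $ j * \<nu> $ i = 0)"

definition K_space ::
  "('n::finite \<Rightarrow> (complex ^ 'l) set) \<Rightarrow> ('n \<times> 'n) set \<Rightarrow> ('a::field ^ 'n) set" where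
  "K_space H \<Gamma> = {\<xi>. \<forall>X\<in>nonclique_lines H \<Gamma>. subsum \<xi> X = 0}"

text \<open>
  The condition \<open>\<lambda>\<^sub>X \<eta>|\<^sub>X = \<eta>\<^sub>X \<lambda>|\<^sub>X\<close> for \<open>X\<close> in \<open>nonclique_lines H \<Gamma>\<close> needs no
  clause of its own: both sums vanish for \<open>\<lambda>\<close> and \<open>\<eta>\<close> in \<open>K\<close>.
\<close>

definition Z_space ::
  "('n::finite \<Rightarrow> (complex ^ 'l) set) \<Rightarrow> ('n \<times> 'n) set \<Rightarrow> 'a::field ^ 'n \<Rightarrow> ('a ^ 'n) set" where
  "Z_space H \<Gamma> lam =
     {\<eta> \<in> K_space H \<Gamma>. \<forall>(i, j)\<in>\<Gamma>. lam $ i * \<eta> $ j - lam $ j * \<eta> $ i = 0}"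

definition V1 ::
  "('n::finite \<Rightarrow> (complex ^ 'l) set) \<Rightarrow> ('n \<times> 'n) set \<Rightarrow> ('a::field ^ 'n) set" where
  "V1 H \<Gamma> = {lam \<in> K_space H \<Gamma>. \<exists>\<eta>\<in>Z_space H \<Gamma> lam. \<not> parallel_vec \<eta> lam}"

definition D_space ::
  "('n::finite \<Rightarrow> (complex ^ 'l) set) \<Rightarrow> ('n \<times> 'n) set \<Rightarrow> 'n set \<Rightarrow> ('a::field ^ 'n) set" where
  "D_space H \<Gamma> S = {\<xi> \<in> K_space H \<Gamma>. \<forall>i\<in>S. \<xi> $ i = 0}"

text \<open>
  The \<open>itself\<close> argument carries the field, on which \<open>dim K\<close> depends.
\<close>

definition NP ::
  "('n::finite \<Rightarrow> (complex ^ 'l) set) \<Rightarrow> 'a::field itself \<Rightarrow> ('n \<times> 'n) set set" where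
  "NP H (_ :: 'a itself) =
     {\<Gamma>. simple_graph \<Gamma> \<and> neighborly H \<Gamma> \<and>
         transitive_graph (induced_subgraph \<Gamma> {i. \<not> cone_vertex \<Gamma> i}) \<and>
         vec.dim (K_space H \<Gamma> :: ('a ^ 'n) set) \<ge> 2}"

text \<open>Points of a projective space are one-dimensional linear subspaces.\<close>

definition Proj :: "('a::field ^ 'n::finite) set \<Rightarrow> ('a ^ 'n) set set" where
  "Proj W = {p. vec.subspace p \<and> vec.dim p = 1 \<and> p \<subseteq> W}"

definition proj_line :: "'a::field ^ 'n::finite \<Rightarrow> 'a ^ 'n \<Rightarrow> ('a ^ 'n) set set" where
  "proj_line lam \<eta> = Proj (vec.span {lam, \<eta>})"

definition V_bar ::
  "('n::finite \<Rightarrow> (complex ^ 'l) set) \<Rightarrow> ('n \<times> 'n) set \<Rightarrow> ('a::field ^ 'n) set set" where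
  "V_bar H \<Gamma> = {vec.span {lam} | lam. lam \<in> V1 H \<Gamma> \<and> lam \<noteq> 0}"

end

(*
  On a clique S the edge equations say that the vectors (lam_i, eta_i), i in S, lie on a common line
  of the plane, i.e. that some nontrivial combination of lam and eta vanishes on S. As every edge
  lies in a block, eta belongs to Z_Gamma(lam) iff this happens for every block. Passing to another
  basis of the span of lam and eta only rescales all 2x2 minors by a common factor, so the condition
  holds at each point of the line lam * eta as soon as it holds at lam.
*)
theory Submission
  imports Defs
begin

abbreviation minor :: "'a::field ^ 'n \<Rightarrow> 'a ^ 'n \<Rightarrow> 'n \<Rightarrow> 'n \<Rightarrow> 'a" where
  "minor x y i j \<equiv> x $ i * y $ j - x $ j * y $ i"

text \<open>Multiplicativity of the 2x2 determinant; the factor is the determinant of the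
  coefficient matrix, which may be singular.\<close>

lemma minor_combination:
  "minor (a *s x + b *s y) (c *s x + d *s y) i j = (a * d - b * c) * minor x y i j"
  by (simp add: algebra_simps)

lemma parallel_vec_commute: "parallel_vec x y \<longleftrightarrow> parallel_vec y x"
  unfolding parallel_vec_def by (metis eq_iff_diff_eq_0 mult.commute)

text \<open>The two-row matrix with rows \<open>x\<close> and \<open>y\<close>, restricted to the
  columns in \<open>S\<close>, has dependent rows exactly when its rank is at most one.\<close>

lemma vanishing_combination_iff_minors:
  fixes x y :: "'a::field ^ 'n"
  shows "(\<exists>a b. (a, b) \<noteq> (0, 0) \<and> (\<forall>i\<in>S. (a *s x + b *s y) $ i = 0)) \<longleftrightarrow>
    (\<forall>i\<in>S. \<forall>j\<in>S. minor x y i j = 0)"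
proof
  assume "\<exists>a b. (a, b) \<noteq> (0, 0) \<and> (\<forall>i\<in>S. (a *s x + b *s y) $ i = 0)"
  then obtain a b where ab: "(a, b) \<noteq> (0, 0)" and z: "\<forall>i\<in>S. (a *s x + b *s y) $ i = 0"
    by blast
  show "\<forall>i\<in>S. \<forall>j\<in>S. minor x y i j = 0"
  proof (intro ballI)
    fix i j assume ij: "i \<in> S" "j \<in> S"
    \<comment> \<open>Pairing the combination with \<open>y\<close>, then with \<open>x\<close>,
      gives coefficient determinants \<open>a\<close> and \<open>- b\<close>; the minors themselves
      vanish because the combination is zero at \<open>i\<close> and \<open>j\<close>.\<close>
    have "a * minor x y i j = 0" "b * minor x y i j = 0"
      using minor_combination[of a x b y i 0 1 j] minor_combination[of a x b y i 1 0 j]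
      by (simp_all only: z[rule_format, OF ij(1)] z[rule_format, OF ij(2)]) simp_all
    with ab show "minor x y i j = 0" by auto
  qed
next
  assume m: "\<forall>i\<in>S. \<forall>j\<in>S. minor x y i j = 0"
  show "\<exists>a b. (a, b) \<noteq> (0, 0) \<and> (\<forall>i\<in>S. (a *s x + b *s y) $ i = 0)"
  proof (cases "\<exists>i\<in>S. (x $ i, y $ i) \<noteq> (0, 0)")
    case True
    then obtain i where "i \<in> S" "(x $ i, y $ i) \<noteq> (0, 0)" by blast
    \<comment> \<open>With these coefficients, entry \<open>j\<close> of the combination is
      \<open>- minor x y i j\<close>.\<close>
    with m show ?thesis
      by (intro exI[of _ "y $ i"] exI[of _ "- x $ i"]) (auto simp: algebra_simps)
  next
    case False
    then show ?thesis
      by (intro exI[of _ 1] exI[of _ 0]) auto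
  qed
qed

text \<open>Non-parallel vectors are linearly independent: this is the preceding equivalence for the
  full index set.\<close>

lemma combination_nonzero:
  fixes x y :: "'a::field ^ 'n"
  assumes "\<not> parallel_vec x y" and "(a, b) \<noteq> (0, 0)"
  shows "a *s x + b *s y \<noteq> 0"
proof
  assume "a *s x + b *s y = 0"
  then have "\<forall>i\<in>UNIV. (a *s x + b *s y) $ i = 0" by simp
  with assms show False
    using vanishing_combination_iff_minors[of UNIV x y] by (auto simp: parallel_vec_def)
qed

lemma mem_span_pair:
  fixes x y :: "'a::field ^ 'n"
  shows "v \<in> vec.span {x, y} \<longleftrightarrow> (\<exists>a b. v = a *s x + b *s y)"
  by (simp add: vec.span_breakdown_eq) (metis add.commute diff_add_cancel add_diff_cancel_left')

text \<open>Lets a projective point be replaced by a nonzero representative, the single element of a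
  basis.\<close>

lemma Proj_conv_span:
  fixes W :: "('a::field ^ 'n::finite) set"
  assumes "vec.subspace W"
  shows "Proj W = {vec.span {v} | v. v \<in> W \<and> v \<noteq> 0}"
proof (intro equalityI subsetI)
  fix p assume "p \<in> Proj W"
  then have p: "vec.subspace p" "vec.dim p = 1" "p \<subseteq> W"
    by (auto simp: Proj_def)
  obtain B where B: "B \<subseteq> p" "vec.independent B" "p \<subseteq> vec.span B" "card B = vec.dim p"
    using vec.basis_exists by blast
  with p(2) obtain v where "B = {v}"
    by (metis card_1_singletonE)
  with B p have "v \<in> W" "v \<noteq> 0" "p = vec.span {v}"
    using vec.span_minimal[of B p] by auto
  then show "p \<in> {vec.span {v} | v. v \<in> W \<and> v \<noteq> 0}" by blast
next
  fix p assume "p \<in> {vec.span {v} | v. v \<in> W \<and> v \<noteq> 0}"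
  then obtain v where v: "v \<in> W" "v \<noteq> 0" "p = vec.span {v}" by blast
  have "vec.dim p = card {v}"
    unfolding v(3) by (rule vec.dim_span_eq_card_independent) (simp add: v(2))
  with v assms show "p \<in> Proj W"
    by (simp add: Proj_def vec.span_minimal)
qed

lemma subspace_K_space: "vec.subspace (K_space H \<Gamma>)"
  by (auto simp: vec.subspace_def K_space_def subsum_def sum.distrib simp flip: sum_distrib_left)

lemma subspace_D_space: "vec.subspace (D_space H \<Gamma> S)"
  using subspace_K_space[of H \<Gamma>] by (auto simp: vec.subspace_def D_space_def)

lemma span_pair_subset_K_space:
  "x \<in> K_space H \<Gamma> \<Longrightarrow> y \<in> K_space H \<Gamma> \<Longrightarrow> vec.span {x, y} \<subseteq> K_space H \<Gamma>"
  by (simp add: vec.span_minimal subspace_K_space)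

text \<open>An edge is a clique on two vertices, and among finitely many cliques some maximal one
  contains it.\<close>

lemma edge_in_block:
  fixes \<Gamma> :: "('n::finite \<times> 'n) set"
  assumes "sym \<Gamma>" and "(i, j) \<in> \<Gamma>"
  obtains S where "block \<Gamma> S" and "i \<in> S" and "j \<in> S"
proof -
  have "clique \<Gamma> {i, j}"
    using assms by (auto simp: clique_def dest: symD)
  then obtain S where "clique \<Gamma> S" "{i, j} \<subseteq> S" "\<forall>T. clique \<Gamma> T \<and> S \<subseteq> T \<longrightarrow> S = T"
    using finite_has_maximal2[of "{S. clique \<Gamma> S}" "{i, j}"] by auto
  then show thesis
    by (intro that[of S]) (auto simp: block_def)
qed

text \<open>A common point is spanned by a nonzero combination of \<open>x\<close> and
  \<open>y\<close> that vanishes on \<open>S\<close>, so the geometric condition becomes the rank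
  condition above.\<close>

lemma proj_line_meets_iff:
  fixes x y :: "'a::field ^ 'n::finite"
  assumes "x \<in> K_space H \<Gamma>" "y \<in> K_space H \<Gamma>" "\<not> parallel_vec x y"
  shows "proj_line x y \<inter> Proj (D_space H \<Gamma> S) \<noteq> {} \<longleftrightarrow> (\<forall>i\<in>S. \<forall>j\<in>S. minor x y i j = 0)"
proof -
  let ?W = "vec.span {x, y} \<inter> D_space H \<Gamma> S"
  have "proj_line x y \<inter> Proj (D_space H \<Gamma> S) = Proj ?W"
    by (auto simp: proj_line_def Proj_def)
  also have "\<dots> \<noteq> {} \<longleftrightarrow> (\<exists>v. v \<in> ?W \<and> v \<noteq> 0)"
    by (subst Proj_conv_span) (auto intro: vec.subspace_inter subspace_D_space)
  \<comment> \<open>Membership in \<open>K_space\<close> is automatic on the span.\<close>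
  also have "\<dots> \<longleftrightarrow> (\<exists>v\<in>vec.span {x, y}. v \<noteq> 0 \<and> (\<forall>i\<in>S. v $ i = 0))"
    using span_pair_subset_K_space[OF assms(1,2)] by (auto simp: D_space_def)
  also have "\<dots> \<longleftrightarrow> (\<exists>a b. a *s x + b *s y \<noteq> 0 \<and> (\<forall>i\<in>S. (a *s x + b *s y) $ i = 0))"
    by (auto simp only: mem_span_pair Bex_def)
  also have "\<dots> \<longleftrightarrow> (\<exists>a b. (a, b) \<noteq> (0, 0) \<and> (\<forall>i\<in>S. (a *s x + b *s y) $ i = 0))"
  proof -
    have "a *s x + b *s y \<noteq> 0 \<longleftrightarrow> (a, b) \<noteq> (0, 0)" for a b
      using combination_nonzero[OF assms(3)] by auto
    then show ?thesis by simp
  qed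
  finally show ?thesis
    by (simp only: vanishing_combination_iff_minors)
qed

text \<open>Edge equations and block equations agree: distinct vertices of a block are adjacent, and
  each edge lies in some block.\<close>

lemma Z_space_iff_proj_line_meets:
  fixes x y :: "'a::field ^ 'n::finite"
  assumes "simple_graph \<Gamma>" "x \<in> K_space H \<Gamma>" "y \<in> K_space H \<Gamma>" "\<not> parallel_vec x y"
  shows "y \<in> Z_space H \<Gamma> x \<longleftrightarrow>
    (\<forall>S. block \<Gamma> S \<longrightarrow> proj_line x y \<inter> Proj (D_space H \<Gamma> S) \<noteq> {})"
proof -
  have "(\<forall>(i, j)\<in>\<Gamma>. minor x y i j = 0) \<longleftrightarrow>
      (\<forall>S. block \<Gamma> S \<longrightarrow> (\<forall>i\<in>S. \<forall>j\<in>S. minor x y i j = 0))" (is "?E \<longleftrightarrow> ?B")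
  proof
    assume E: ?E
    show ?B
    proof (intro allI impI ballI)
      fix S i j assume "block \<Gamma> S" "i \<in> S" "j \<in> S"
      then have "i = j \<or> (i, j) \<in> \<Gamma>" by (auto simp: block_def clique_def)
      with E show "minor x y i j = 0" by auto
    qed
  next
    assume B: ?B
    show ?E
    proof clarify
      fix i j assume "(i, j) \<in> \<Gamma>"
      then obtain S where "block \<Gamma> S" "i \<in> S" "j \<in> S"
        using assms(1) edge_in_block by (metis simple_graph_def)
      with B show "minor x y i j = 0" by blast
    qed
  qed
  with assms(3) show ?thesis
    by (simp add: Z_space_def proj_line_meets_iff[OF assms(2-4)])
qed

lemma proj_line_subset_V_bar:
  fixes x y :: "'a::field ^ 'n::finite"
  assumes x: "x \<in> K_space H \<Gamma>" and y: "y \<in> Z_space H \<Gamma> x" and np: "\<not> parallel_vec x y"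
  shows "proj_line x y \<subseteq> V_bar H \<Gamma>"
proof
  fix p assume "p \<in> proj_line x y"
  then obtain v where v: "v \<in> vec.span {x, y}" "v \<noteq> 0" "p = vec.span {v}"
    by (auto simp: proj_line_def Proj_conv_span)
  then obtain a b where ab: "v = a *s x + b *s y"
    by (auto simp: mem_span_pair)
  with v(2) have ab_nz: "(a, b) \<noteq> (0, 0)" by auto
  \<comment> \<open>Completes \<open>(a, b)\<close> to an invertible coefficient matrix. In the
    instantiations below \<open>d\<close> comes before \<open>c\<close>: the determinant is
    \<open>- b\<close> if \<open>a = 0\<close>, and \<open>a\<close> otherwise.\<close>
  obtain c d where cd: "a * d - b * c \<noteq> 0"
  proof (cases "a = 0")
    case True
    with ab_nz show thesis by (intro that[of 0 1]) auto
  next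
    case False
    then show thesis by (intro that[of 1 0]) auto
  qed
  \<comment> \<open>The second basis vector of the plane; it is the witness that \<open>v\<close>
    lies in \<open>V1\<close>.\<close>
  define w where "w = c *s x + d *s y"
  have m: "minor v w i j = (a * d - b * c) * minor x y i j" for i j
    unfolding ab w_def by (rule minor_combination)
  have K: "vec.span {x, y} \<subseteq> K_space H \<Gamma>"
    using x y by (intro span_pair_subset_K_space) (simp_all add: Z_space_def)
  have "w \<in> vec.span {x, y}"
    unfolding mem_span_pair w_def by blast
  moreover have "\<forall>(i, j)\<in>\<Gamma>. minor v w i j = 0"
    using y unfolding m by (auto simp: Z_space_def)
  ultimately have "w \<in> Z_space H \<Gamma> v"
    using K by (auto simp: Z_space_def)
  \<comment> \<open>The minors of \<open>v\<close> and \<open>w\<close> are those of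
    \<open>x\<close> and \<open>y\<close> times a nonzero factor, so some minor survives.\<close>
  moreover have "\<not> parallel_vec w v"
    using np cd unfolding parallel_vec_commute[of w v] by (auto simp: parallel_vec_def m)
  ultimately have "v \<in> V1 H \<Gamma>"
    using K v(1) by (auto simp: V1_def)
  with v show "p \<in> V_bar H \<Gamma>" by (auto simp: V_bar_def)
qed

theorem theorem4p1:
  fixes H :: "'n::finite \<Rightarrow> (complex ^ 'l) set"
    and \<Gamma> :: "('n \<times> 'n) set"
  assumes "arrangement H"
    and "\<Gamma> \<in> NP H TYPE('a::alg_closed_field)"
    and "(V_bar H \<Gamma> :: ('a ^ 'n) set set) \<noteq> {}"
  shows "(\<forall>lam \<in> (V1 H \<Gamma> :: ('a ^ 'n) set). \<forall>\<eta> \<in> Z_space H \<Gamma> lam.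
            \<not> parallel_vec \<eta> lam \<longrightarrow>
            (\<forall>S. block \<Gamma> S \<longrightarrow> proj_line lam \<eta> \<inter> Proj (D_space H \<Gamma> S) \<noteq> {}))
       \<and> (\<forall>lam \<in> (K_space H \<Gamma> :: ('a ^ 'n) set). \<forall>\<eta> \<in> K_space H \<Gamma>.
            \<not> parallel_vec lam \<eta> \<longrightarrow>
            (\<forall>S. block \<Gamma> S \<longrightarrow> proj_line lam \<eta> \<inter> Proj (D_space H \<Gamma> S) \<noteq> {}) \<longrightarrow>
            proj_line lam \<eta> \<subseteq> V_bar H \<Gamma>)"
proof (intro conjI ballI impI)
  have \<Gamma>: "simple_graph \<Gamma>"
    using assms(2) by (simp add: NP_def)
  {
    fix lam \<eta> :: "'a ^ 'n"
    assume "lam \<in> V1 H \<Gamma>" "\<eta> \<in> Z_space H \<Gamma> lam" "\<not> parallel_vec \<eta> lam"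
    then show "\<forall>S. block \<Gamma> S \<longrightarrow> proj_line lam \<eta> \<inter> Proj (D_space H \<Gamma> S) \<noteq> {}"
      using Z_space_iff_proj_line_meets[OF \<Gamma>, of lam H \<eta>]
      by (simp add: V1_def Z_space_def parallel_vec_commute)
  next
    fix lam \<eta> :: "'a ^ 'n"
    assume "lam \<in> K_space H \<Gamma>" "\<eta> \<in> K_space H \<Gamma>" "\<not> parallel_vec lam \<eta>"
      "\<forall>S. block \<Gamma> S \<longrightarrow> proj_line lam \<eta> \<inter> Proj (D_space H \<Gamma> S) \<noteq> {}"
    \<comment> \<open>The block condition first puts \<open>\<eta>\<close> into
      \<open>Z_space H \<Gamma> lam\<close>; the change of basis then reaches every point of the
      line.\<close>
    then show "proj_line lam \<eta> \<subseteq> V_bar H \<Gamma>"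
      using Z_space_iff_proj_line_meets[OF \<Gamma>] proj_line_subset_V_bar by blast
  }
qed

end
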